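(* Let $\mu\in\mathbb{R}$ with $\mu\neq 0$ and let $t>0$. For $\nu\neq 0$, let $T_{\nu,t}$ denote the last zero crossing time in $[0,t]$ of a Brownian motion with drift $\nu$ started at the origin. Then, for every choice of positive numbers $\{\gamma_r:r>0\}$ such that $$\lim_{r\to\infty}\gamma_r=0\quad\text{and}\quad\lim_{r\to\infty}r\gamma_r=\infty,$$ the family of random variables $\{r\gamma_r T_{\mu\sqrt{r},t}:r>0\}$ satisfies, as $r\to\infty$, the large deviation principle with speed $v_r=1/\gamma_r$ and good rate function $\tilde{J}:\mathbb{R}\to[0,\infty]$ defined by $$\tilde{J}(b):=\begin{cases}\frac{\mu^2}{2}b & \text{if } b\in[0,\infty),\\ \infty & \text{otherwise.}\end{cases}$$
   Context: Last zero crossing time: for $\nu\neq 0$ and $t>0$, let $B^{\nu}(s)=B(s)+\nu s$, $s\ge 0$, where $B$ is a standard Brownian motion with $B(0)=0$, and let $T_{\nu,t}=\sup\{s\in[0,t]:B^{\nu}(s)=0\}$. It is known (a recalled fact from earlier literature) that the distribution function of $T_{\nu,t}$ is $$P(T_{\nu,t}\leq a)=1-\frac{2}{\pi}\int_0^{\sqrt{\frac{t-a}{a}}}\frac{e^{-\frac{\nu^2}{2}a(1+y^2)}}{1+y^2}\,dy\quad (a\in[0,t]),$$ (with upper limit $\infty$ when $a=0$), and that its density is $$f_{\nu,t}(a)=\left(\frac{e^{-\frac{\nu^2}{2}t}}{\pi\sqrt{a(t-a)}}+\frac{\nu^2}{2\pi}\int_a^t\frac{e^{-\frac{\nu^2}{2}y}}{\sqrt{a(y-a)}}\,dy\right)1_{[0,t]}(a).$$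 Large deviation principle (LDP): a family of real-valued random variables $\{W(r):r>0\}$ satisfies the LDP with speed $v_r$ and rate function $I$ if $\lim_{r\to\infty}v_r=\infty$, the function $I:\mathbb{R}\to[0,\infty]$ is lower semi-continuous, and $$\limsup_{r\to\infty}\frac{1}{v_r}\log P(W(r)\in C)\leq-\inf_{w\in C}I(w)\quad\text{for all closed sets } C\subseteq\mathbb{R},$$ $$\liminf_{r\to\infty}\frac{1}{v_r}\log P(W(r)\in G)\geq-\inf_{w\in G}I(w)\quad\text{for all open sets } G\subseteq\mathbb{R}.$$ (Conventions: $\log 0=-\infty$ and $\inf\emptyset=\infty$. Only the laws of the $W(r)$ matter.) The rate function $I$ is good if all its level sets $\{w\in\mathbb{R}:I(w)\leq\eta\}$, $\eta\geq 0$, are compact. *)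

theory Defs
  imports "HOL-Probability.Probability"
begin

text \<open>The time parameter ranges over all reals for typing reasons, but nothing is assumed about
  \<open>B s\<close> for \<open>s < 0\<close>. Paths start at 0 and are continuous for every outcome, not merely almost
  surely, so that functionals of the path are well-defined random variables even when the
  probability space is not complete.\<close>

locale standard_brownian_motion = prob_space M for M :: "'a measure" +
  fixes B :: "real \<Rightarrow> 'a \<Rightarrow> real"
  assumes rv: "s \<ge> 0 \<Longrightarrow> B s \<in> borel_measurable M"
    and start: "\<omega> \<in> space M \<Longrightarrow> B 0 \<omega> = 0"
    and continuous_paths: "\<omega> \<in> space M \<Longrightarrow> continuous_on {0..} (\<lambda>s. B s \<omega>)"
    and normal_increments: "0 \<le> s \<Longrightarrow> s < u \<Longrightarrow>
      distributed M lborel (\<lambda>\<omega>. B u \<omega> - B s \<omega>) (normal_density 0 (sqrt (u - s)))"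
    and independent_increments: "0 \<le> \<tau> 0 \<Longrightarrow> (\<And>i. i < n \<Longrightarrow> \<tau> i \<le> \<tau> (Suc i)) \<Longrightarrow>
      indep_vars (\<lambda>_. borel) (\<lambda>i \<omega>. B (\<tau> (Suc i)) \<omega> - B (\<tau> i) \<omega>) {..<n::nat}"

definition with_drift :: "(real \<Rightarrow> 'a \<Rightarrow> real) \<Rightarrow> real \<Rightarrow> real \<Rightarrow> 'a \<Rightarrow> real" where
  "with_drift B \<nu> s \<omega> = B s \<omega> + \<nu> * s"

definition last_zero :: "(real \<Rightarrow> 'a \<Rightarrow> real) \<Rightarrow> real \<Rightarrow> 'a \<Rightarrow> real" where
  "last_zero X t \<omega> = Sup {s \<in> {0..t}. X s \<omega> = 0}"

text \<open>The library's \<^const>\<open>ln\<close> is real-valued with \<open>ln 0 = 0\<close>; large deviation bounds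
  need \<open>log 0 = -\<infinity>\<close>.\<close>

definition log_prob :: "real \<Rightarrow> ereal" where
  "log_prob p = (if p = 0 then -\<infinity> else ereal (ln p))"

definition lower_semicontinuous :: "('a::topological_space \<Rightarrow> ereal) \<Rightarrow> bool" where
  "lower_semicontinuous f \<longleftrightarrow> (\<forall>x. f x \<le> Liminf (at x) f)"

text \<open>Each \<open>W r\<close> may live on its own probability space \<open>M r\<close>. The speed eventually being
  positive, the product of \<open>1 / v r\<close> with \<open>-\<infinity>\<close> is \<open>-\<infinity>\<close>.\<close>

definition large_deviation_principle ::
  "(real \<Rightarrow> 'a measure) \<Rightarrow> (real \<Rightarrow> 'a \<Rightarrow> real) \<Rightarrow> (real \<Rightarrow> real) \<Rightarrow> (real \<Rightarrow> ereal) \<Rightarrow> bool" where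
  "large_deviation_principle M W v I \<longleftrightarrow>
     (\<forall>r>0. prob_space (M r) \<and> W r \<in> borel_measurable (M r)) \<and>
     filterlim v at_top at_top \<and>
     (\<forall>w. 0 \<le> I w) \<and> lower_semicontinuous I \<and>
     (\<forall>C. closed C \<longrightarrow>
        Limsup at_top (\<lambda>r. ereal (1 / v r) * log_prob (measure (M r) {\<omega> \<in> space (M r). W r \<omega> \<in> C}))
          \<le> - (INF w\<in>C. I w)) \<and>
     (\<forall>G. open G \<longrightarrow>
        Liminf at_top (\<lambda>r. ereal (1 / v r) * log_prob (measure (M r) {\<omega> \<in> space (M r). W r \<omega> \<in> G}))
          \<ge> - (INF w\<in>G. I w))"

definition good_rate_function :: "(real \<Rightarrow> ereal) \<Rightarrow> bool" where
  "good_rate_function I \<longleftrightarrow> (\<forall>\<eta>::real. \<eta> \<ge> 0 \<longrightarrow> compact {w. I w \<le> ereal \<eta>})"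

end

theory Submission
  imports Defs
begin

text \<open>Write \<open>X s = B s + \<nu> * s\<close> and let \<open>T\<close> be the last zero of \<open>X\<close> in \<open>[0, t]\<close>. On the
exponential scale two elementary estimates determine the law of \<open>T\<close>, and both come from asking
when \<open>\<nu> * X s \<le> 0\<close>, that is, when the path is on the wrong side of zero for its drift. Phrasing
everything in terms of \<open>\<nu> * X s\<close> treats both signs of \<open>\<nu>\<close> at once.

Upper estimate. Where \<open>\<nu> * X s \<le> 0\<close>, the exponential martingale
\<open>exp (- \<nu> * B s - \<nu>\<^sup>2 * s / 2)\<close> is at least \<open>exp (\<nu>\<^sup>2 * s / 2)\<close>. Doob's maximal inequality thus
bounds the probability that this happens at some time in \<open>[a, t]\<close> by \<open>exp (- \<nu>\<^sup>2 * a / 2)\<close>, and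
\<open>T \<ge> a\<close> forces it to happen, since \<open>X\<close> has a zero in \<open>[a, t]\<close>.

Lower estimate. For \<open>a < b \<le> t\<close>, if \<open>\<nu> * X a \<le> 0\<close> but \<open>\<nu> * X s > 0\<close> throughout \<open>[b, t]\<close>, then
\<open>a \<le> T < b\<close> by the intermediate value theorem. Hence \<open>P (a \<le> T < b)\<close> is at least
\<open>P (\<nu> * X a \<le> 0) - exp (- \<nu>\<^sup>2 * b / 2)\<close>. The first probability is a Gaussian tail, of order
\<open>exp (- \<nu>\<^sup>2 * a / 2)\<close> on the exponential scale, and it dominates the second because \<open>a < b\<close>.

With \<open>\<nu> = \<mu> * sqrt r\<close> and \<open>a = w / (r * \<gamma>)\<close> the exponent \<open>\<nu>\<^sup>2 * a / 2\<close> becomes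
\<open>(\<mu>\<^sup>2 / 2 * w) / \<gamma>\<close>, which is the rate function at \<open>w\<close> times the speed \<open>1 / \<gamma>\<close>. The assumption
\<open>r * \<gamma> \<rightarrow> \<infinity>\<close> moves \<open>b / (r * \<gamma>)\<close> into \<open>[0, t]\<close> for every fixed \<open>b\<close>, and \<open>\<gamma> \<rightarrow> 0\<close> makes the
correction terms of the Gaussian tail vanish.\<close>

section \<open>A maximal inequality for products of independent variables\<close>

text \<open>The martingale of partial products of \<open>y\<close>, stopped when it first reaches the level \<open>c\<close>: the
factor \<open>y i\<close> is included only as long as no partial product up to that point has reached \<open>c\<close>.
Writing the stopped process as a product makes its one-step recursion immediate.\<close>

definition stopped_prod :: "real \<Rightarrow> nat \<Rightarrow> (nat \<Rightarrow> real) \<Rightarrow> real" where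
  "stopped_prod c n y = (\<Prod>i<n. if \<forall>j\<le>i. (\<Prod>l<j. y l) < c then y i else 1)"

text \<open>Once the level has been reached, all later factors are 1, so the stopped product keeps the value
it had at that time; until then it is the ordinary partial product. The induction needs both
halves, hence the case distinction in the strengthened claim.\<close>

lemma stopped_prod_ge:
  "(\<exists>k\<le>n. c \<le> (\<Prod>i<k. y i)) \<Longrightarrow> c \<le> stopped_prod c n y"
proof -
  have "if \<exists>k\<le>n. c \<le> (\<Prod>i<k. y i) then c \<le> stopped_prod c n y
    else stopped_prod c n y = (\<Prod>i<n. y i)"
  proof (induction n)
    case 0
    then show ?case by (simp add: stopped_prod_def)
  next
    case (Suc n)
    have step: "stopped_prod c (Suc n) y =
        stopped_prod c n y * (if \<forall>j\<le>n. (\<Prod>l<j. y l) < c then y n else 1)"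
      by (simp add: stopped_prod_def)
    show ?case
    proof (cases "\<exists>k\<le>n. c \<le> (\<Prod>i<k. y i)")
      case True
      then have "\<not> (\<forall>j\<le>n. (\<Prod>l<j. y l) < c)" by (meson not_le)
      moreover have "\<exists>k\<le>Suc n. c \<le> (\<Prod>i<k. y i)" using True le_SucI by blast
      ultimately show ?thesis using Suc True by (simp only: step if_True if_False mult_1_right)
    next
      case False
      then have "\<forall>j\<le>n. (\<Prod>l<j. y l) < c" by (meson not_le)
      then have "stopped_prod c (Suc n) y = (\<Prod>i<Suc n. y i)"
        using Suc False by (simp only: step if_True if_False) simp
      moreover have "(\<exists>k\<le>Suc n. c \<le> (\<Prod>i<k. y i)) \<longleftrightarrow> c \<le> (\<Prod>i<Suc n. y i)"
        using False le_Suc_eq by auto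
      ultimately show ?thesis by simp
    qed
  qed
  then show "(\<exists>k\<le>n. c \<le> (\<Prod>i<k. y i)) \<Longrightarrow> c \<le> stopped_prod c n y" by simp
qed

text \<open>Optional stopping: whether step \<open>k\<close> is still running depends on \<open>Y 0, \<dots>, Y (k - 1)\<close> only. On that
event the stopped product is multiplied by the independent factor \<open>Y k\<close> of mean 1, and elsewhere
it does not change, so its expectation is preserved.\<close>

lemma (in prob_space) stopped_prod_expectation:
  fixes Y :: "nat \<Rightarrow> 'a \<Rightarrow> real"
  assumes indep: "indep_vars (\<lambda>_. borel) Y {..<n}"
    and Y: "\<And>i. i < n \<Longrightarrow> has_bochner_integral M (Y i) 1"
  shows "k \<le> n \<Longrightarrow> has_bochner_integral M (\<lambda>\<omega>. stopped_prod c k (\<lambda>i. Y i \<omega>)) 1"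
proof (induction k)
  case 0
  then show ?case
    by (simp add: stopped_prod_def has_bochner_integral_iff prob_space)
next
  case (Suc k)
  then have k: "k < n" by simp
  define S where "S = (\<lambda>\<omega>. stopped_prod c k (\<lambda>i. Y i \<omega>))"
  define run where "run = (\<lambda>y. \<forall>j\<le>k. (\<Prod>l<j. y l) < c)"
  \<comment> \<open>\<open>f\<close> is the part of the stopped product that is still running, the only part multiplied by \<open>Y k\<close>.\<close>
  define f where "f = (\<lambda>y. if run y then stopped_prod c k y else 0)"
  have rv [measurable]: "\<And>i. i < n \<Longrightarrow> Y i \<in> borel_measurable M"
    using Y by (auto simp: has_bochner_integral_iff)
  have intS: "integrable M S" "integral\<^sup>L M S = 1"
    using Suc unfolding S_def by (auto simp: has_bochner_integral_iff)
  have intY: "integrable M (Y k)" "integral\<^sup>L M (Y k) = 1"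
    using Y[OF k] by (auto simp: has_bochner_integral_iff)
  have f_meas: "f \<in> borel_measurable (PiM {..<k} (\<lambda>_. borel))"
    unfolding f_def run_def stopped_prod_def by measurable
  have f_restrict: "f (restrict y {..<k}) = f y" for y
    unfolding f_def run_def stopped_prod_def
    by (intro if_cong prod.cong all_cong arg_cong2[where f="(<)"] refl) auto
  have "indep_var borel (f \<circ> (\<lambda>\<omega>. restrict (\<lambda>i. Y i \<omega>) {..<k}))
      borel ((\<lambda>y. y k) \<circ> (\<lambda>\<omega>. restrict (\<lambda>i. Y i \<omega>) {k}))"
    using k by (intro indep_var_compose[OF indep_var_restrict[OF indep]] f_meas) auto
  then have ind: "indep_var borel (\<lambda>\<omega>. f (\<lambda>i. Y i \<omega>)) borel (Y k)"
    by (simp add: comp_def f_restrict)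
  have run_meas [measurable]: "Measurable.pred M (\<lambda>\<omega>. run (\<lambda>i. Y i \<omega>))"
  proof -
    have "Measurable.pred M (\<lambda>\<omega>. (\<Prod>l<j. Y l \<omega>) < c)" if "j \<le> k" for j
    proof -
      have "(\<lambda>\<omega>. \<Prod>l<j. Y l \<omega>) \<in> borel_measurable M"
        using that k by (intro borel_measurable_prod) auto
      then show ?thesis by measurable
    qed
    then show ?thesis unfolding run_def by measurable
  qed
  have f_eq: "f (\<lambda>i. Y i \<omega>) = indicator {\<omega>\<in>space M. run (\<lambda>i. Y i \<omega>)} \<omega> * S \<omega>"
    if "\<omega> \<in> space M" for \<omega>
    using that by (simp add: f_def S_def indicator_def)
  have "integrable M (\<lambda>\<omega>. indicator {\<omega>\<in>space M. run (\<lambda>i. Y i \<omega>)} \<omega> *\<^sub>R S \<omega>)"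
    by (intro integrable_mult_indicator intS) measurable
  then have int_f: "integrable M (\<lambda>\<omega>. f (\<lambda>i. Y i \<omega>))"
    by (subst Bochner_Integration.integrable_cong[OF refl f_eq]) auto
  have step: "stopped_prod c (Suc k) (\<lambda>i. Y i \<omega>) =
      S \<omega> - f (\<lambda>i. Y i \<omega>) + f (\<lambda>i. Y i \<omega>) * Y k \<omega>" for \<omega>
  proof -
    have "stopped_prod c (Suc k) y = stopped_prod c k y * (if run y then y k else 1)" for y
      unfolding stopped_prod_def run_def by (simp only: prod.lessThan_Suc)
    then show ?thesis by (simp add: S_def f_def)
  qed
  have "has_bochner_integral M (\<lambda>\<omega>. f (\<lambda>i. Y i \<omega>) * Y k \<omega>) (integral\<^sup>L M (\<lambda>\<omega>. f (\<lambda>i. Y i \<omega>)))"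
    using indep_var_lebesgue_integral[OF ind int_f intY(1)]
      indep_var_integrable[OF ind int_f intY(1)] intY(2)
    by (simp add: has_bochner_integral_iff)
  moreover have "has_bochner_integral M (\<lambda>\<omega>. S \<omega> - f (\<lambda>i. Y i \<omega>))
      (1 - integral\<^sup>L M (\<lambda>\<omega>. f (\<lambda>i. Y i \<omega>)))"
    using intS int_f by (simp add: has_bochner_integral_iff)
  ultimately show ?case
    unfolding step using has_bochner_integral_add by fastforce
qed

text \<open>Doob's maximal inequality for a nonnegative martingale that is a product of independent factors:
Markov's inequality applied to the stopped product.\<close>

lemma (in prob_space) prod_maximal_inequality:
  fixes Y :: "nat \<Rightarrow> 'a \<Rightarrow> real"
  assumes indep: "indep_vars (\<lambda>_. borel) Y {..<n}"
    and Y: "\<And>i. i < n \<Longrightarrow> has_bochner_integral M (Y i) 1"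
    and nonneg: "\<And>i \<omega>. 0 \<le> Y i \<omega>" and "c > 0"
  shows "prob {\<omega>\<in>space M. \<exists>k\<le>n. c \<le> (\<Prod>i<k. Y i \<omega>)} \<le> 1 / c"
proof -
  let ?S = "\<lambda>\<omega>. stopped_prod c n (\<lambda>i. Y i \<omega>)"
  have S: "integrable M ?S" "integral\<^sup>L M ?S = 1"
    using stopped_prod_expectation[OF indep Y order_refl] by (auto simp: has_bochner_integral_iff)
  then have [measurable]: "?S \<in> borel_measurable M" by auto
  have "prob {\<omega>\<in>space M. \<exists>k\<le>n. c \<le> (\<Prod>i<k. Y i \<omega>)} \<le> prob {\<omega>\<in>space M. c \<le> ?S \<omega>}"
    by (intro finite_measure_mono) (auto intro: stopped_prod_ge)
  also have "\<dots> \<le> integral\<^sup>L M ?S / c"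
    using S(1) \<open>c > 0\<close> nonneg
    by (intro integral_Markov_inequality_measure[where A="{}"])
       (auto simp: stopped_prod_def intro!: prod_nonneg)
  finally show ?thesis using S(2) by simp
qed

section \<open>The exponential martingale of Brownian motion\<close>

text \<open>Completing the square: exponential tilting of a centred Gaussian only shifts its mean. This gives
the exponential moments of the increments without computing an integral.\<close>

lemma exp_tilted_normal_density:
  assumes "\<sigma> > 0"
  shows "normal_density 0 \<sigma> x * exp (\<theta> * x - \<theta>\<^sup>2 * \<sigma>\<^sup>2 / 2) = normal_density (\<theta> * \<sigma>\<^sup>2) \<sigma> x"
proof -
  have "- (x\<^sup>2 / (2 * \<sigma>\<^sup>2)) + (\<theta> * x - \<theta>\<^sup>2 * \<sigma>\<^sup>2 / 2) = - ((x - \<theta> * \<sigma>\<^sup>2)\<^sup>2 / (2 * \<sigma>\<^sup>2))"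
    using assms by (simp add: divide_simps power2_eq_square) algebra
  then show ?thesis by (simp add: normal_density_def flip: exp_add)
qed

context standard_brownian_motion
begin

lemma expectation_exp_increment:
  assumes "0 \<le> s" "s < u"
  shows "has_bochner_integral M (\<lambda>\<omega>. exp (\<theta> * (B u \<omega> - B s \<omega>) - \<theta>\<^sup>2 * (u - s) / 2)) 1"
proof -
  let ?g = "\<lambda>x. exp (\<theta> * x - \<theta>\<^sup>2 * (u - s) / 2)"
  let ?\<sigma> = "sqrt (u - s)"
  note D = normal_increments[OF assms]
  have pos: "?\<sigma> > 0" using assms by simp
  have eq: "(\<lambda>x. normal_density 0 ?\<sigma> x * ?g x) = normal_density (\<theta> * ?\<sigma>\<^sup>2) ?\<sigma>"
    using exp_tilted_normal_density[OF pos, of _ \<theta>] assms by simp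
  have "integrable M (\<lambda>\<omega>. ?g (B u \<omega> - B s \<omega>))"
    by (subst distributed_integrable[OF D, symmetric]) (auto simp: eq integrable_normal_density[OF pos] simp del: real_sqrt_pow2)
  moreover have "integral\<^sup>L M (\<lambda>\<omega>. ?g (B u \<omega> - B s \<omega>)) = 1"
    by (subst distributed_integral[OF D, symmetric]) (auto simp: eq integral_normal_density[OF pos] simp del: real_sqrt_pow2)
  ultimately show ?thesis by (simp add: has_bochner_integral_iff)
qed

lemma exp_martingale_maximal_grid:
  fixes t :: real and N :: nat
  assumes "t > 0" "N > 0" "c > 0"
  shows "prob {\<omega>\<in>space M. \<exists>k::nat\<le>N. c \<le> exp (\<theta> * B (t * k / N) \<omega> - \<theta>\<^sup>2 * (t * k / N) / 2)} \<le> 1 / c"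
proof -
  define \<tau> where "\<tau> = (\<lambda>i::nat. t * i / N)"
  define Y where "Y = (\<lambda>i \<omega>. exp (\<theta> * (B (\<tau> (Suc i)) \<omega> - B (\<tau> i) \<omega>) - \<theta>\<^sup>2 * (\<tau> (Suc i) - \<tau> i) / 2))"
  have \<tau>: "0 \<le> \<tau> i" "\<tau> i < \<tau> (Suc i)" for i
    using assms by (auto simp: \<tau>_def divide_simps)
  have "indep_vars (\<lambda>_. borel) (\<lambda>i \<omega>. B (\<tau> (Suc i)) \<omega> - B (\<tau> i) \<omega>) {..<N}"
    using \<tau> by (intro independent_increments) (auto intro: less_imp_le)
  then have indep: "indep_vars (\<lambda>_. borel) Y {..<N}"
    unfolding Y_def
    by (rule indep_vars_compose2[where Y="\<lambda>i x. exp (\<theta> * x - \<theta>\<^sup>2 * (\<tau> (Suc i) - \<tau> i) / 2)"]) measurable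
  have prod: "(\<Prod>i<k. Y i \<omega>) = exp (\<theta> * B (\<tau> k) \<omega> - \<theta>\<^sup>2 * \<tau> k / 2)" if "\<omega> \<in> space M" for k \<omega>
  proof (induction k)
    case 0
    then show ?case using start[OF that] by (simp add: \<tau>_def)
  next
    case (Suc k)
    then show ?case by (simp add: Y_def algebra_simps diff_divide_distrib flip: exp_add)
  qed
  have "prob {\<omega>\<in>space M. \<exists>k\<le>N. c \<le> (\<Prod>i<k. Y i \<omega>)} \<le> 1 / c"
    using indep \<tau> assms unfolding Y_def
    by (intro prod_maximal_inequality expectation_exp_increment) auto
  also have "{\<omega>\<in>space M. \<exists>k\<le>N. c \<le> (\<Prod>i<k. Y i \<omega>)} =
      {\<omega>\<in>space M. \<exists>k::nat\<le>N. c \<le> exp (\<theta> * B (t * k / N) \<omega> - \<theta>\<^sup>2 * (t * k / N) / 2)}"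
    using prod by (auto simp: \<tau>_def)
  finally show ?thesis .
qed

end

lemma dyadic_floor_approximation:
  fixes s t :: real
  assumes "0 \<le> s" "s \<le> t" "t > 0"
  defines "k \<equiv> \<lambda>n. nat \<lfloor>2 ^ n * s / t\<rfloor>"
  shows "k n \<le> 2 ^ n" and "(\<lambda>n. t * k n / 2 ^ n) \<longlonglongrightarrow> s"
proof -
  have k: "real (k n) \<le> 2 ^ n * s / t" "2 ^ n * s / t \<le> real (k n) + 1" for n
    using assms unfolding k_def by (simp, linarith)
  have "2 ^ n * s / t \<le> 2 ^ n" using assms by (simp add: divide_simps)
  then have "real (k n) \<le> 2 ^ n" using k(1)[of n] by linarith
  then show "k n \<le> 2 ^ n" by (metis of_nat_le_iff of_nat_numeral of_nat_power)
  show "(\<lambda>n. t * k n / 2 ^ n) \<longlonglongrightarrow> s"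
  proof (rule tendsto_sandwich)
    show "\<forall>\<^sub>F n in sequentially. s - t / 2 ^ n \<le> t * k n / 2 ^ n"
    proof (intro always_eventually allI)
      fix n
      have "s \<le> (t * k n + t) / 2 ^ n"
        using k(2)[of n] assms(3) by (simp add: field_simps)
      then show "s - t / 2 ^ n \<le> t * k n / 2 ^ n" by (simp add: add_divide_distrib)
    qed
    show "\<forall>\<^sub>F n in sequentially. t * k n / 2 ^ n \<le> s"
      using k(1) assms(3) by (intro always_eventually allI) (simp add: field_simps)
    have "(\<lambda>n. s - t * (1 / 2) ^ n) \<longlonglongrightarrow> s - t * 0"
      by (intro tendsto_intros LIMSEQ_power_zero) auto
    then show "(\<lambda>n. s - t / 2 ^ n) \<longlonglongrightarrow> s" by (simp add: power_divide)
  qed simp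
qed

context standard_brownian_motion
begin

text \<open>Passage from grids to continuous time. By path continuity a strict crossing of \<open>c\<close> at any time is
seen on every sufficiently fine dyadic grid. Dyadic grids are nested, so the events for the
single grids increase, and their common bound passes to the union.\<close>

lemma exp_martingale_maximal:
  assumes "t > 0" "c > 0"
    and E: "E \<in> sets M"
    and crossing: "\<And>\<omega>. \<omega> \<in> E \<Longrightarrow> \<exists>s\<in>{0..t}. c < exp (\<theta> * B s \<omega> - \<theta>\<^sup>2 * s / 2)"
  shows "prob E \<le> 1 / c"
proof -
  let ?Z = "\<lambda>s \<omega>. exp (\<theta> * B s \<omega> - \<theta>\<^sup>2 * s / 2)"
  define A where "A = (\<lambda>n. {\<omega>\<in>space M. \<exists>k::nat\<le>2 ^ n. c \<le> ?Z (t * k / real (2 ^ n)) \<omega>})"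
  have [measurable]: "B (t * real k / real (2 ^ n)) \<in> borel_measurable M" for k n
    using assms(1) by (intro rv) auto
  have A: "A n \<in> sets M" for n
    unfolding A_def by measurable
  have "incseq A"
  proof (intro incseq_SucI subsetI)
    fix n \<omega> assume "\<omega> \<in> A n"
    then obtain k :: nat where k: "\<omega> \<in> space M" "k \<le> 2 ^ n" "c \<le> ?Z (t * k / real (2 ^ n)) \<omega>"
      unfolding A_def by blast
    then show "\<omega> \<in> A (Suc n)"
      unfolding A_def by (auto simp: ac_simps intro!: exI[of _ "2 * k"])
  qed
  have "E \<subseteq> (\<Union>n. A n)"
  proof
    fix \<omega> assume "\<omega> \<in> E"
    then have \<omega>: "\<omega> \<in> space M" using E sets.sets_into_space by blast
    obtain s where s: "s \<in> {0..t}" "c < ?Z s \<omega>" using crossing[OF \<open>\<omega> \<in> E\<close>] by blast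
    define k where "k = (\<lambda>n. nat \<lfloor>2 ^ n * s / t\<rfloor>)"
    have k: "k n \<le> 2 ^ n" "(\<lambda>n. t * k n / 2 ^ n) \<longlonglongrightarrow> s" for n
      using dyadic_floor_approximation[of s t] s(1) assms(1) unfolding k_def by auto
    have "continuous_on {0..} (\<lambda>s. ?Z s \<omega>)"
      by (intro continuous_intros continuous_paths \<omega>) auto
    then have "(\<lambda>n. ?Z (t * k n / 2 ^ n) \<omega>) \<longlonglongrightarrow> ?Z s \<omega>"
      by (rule continuous_on_tendsto_compose[OF _ k(2)]) (use s(1) assms(1) in auto)
    then have "\<forall>\<^sub>F n in sequentially. c < ?Z (t * k n / 2 ^ n) \<omega>"
      using s(2) by (rule order_tendstoD)
    then obtain n where "c < ?Z (t * k n / 2 ^ n) \<omega>"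
      unfolding eventually_sequentially by blast
    then have "\<omega> \<in> A n"
      unfolding A_def using \<omega> k(1)[of n] by (auto intro!: exI[of _ "k n"])
    then show "\<omega> \<in> (\<Union>n. A n)" by blast
  qed
  then have "prob E \<le> prob (\<Union>n. A n)"
    using A by (intro finite_measure_mono) auto
  also have "\<dots> \<le> 1 / c"
  proof (rule LIMSEQ_le_const2)
    show "(\<lambda>n. prob (A n)) \<longlonglongrightarrow> prob (\<Union>n. A n)"
      using A \<open>incseq A\<close> by (intro finite_Lim_measure_incseq) auto
    show "\<exists>N. \<forall>n\<ge>N. prob (A n) \<le> 1 / c"
    proof -
      have "prob (A n) \<le> 1 / c" for n
        unfolding A_def using exp_martingale_maximal_grid[of t "2 ^ n" c \<theta>] assms by simp
      then show ?thesis by blast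
    qed
  qed
  finally show ?thesis .
qed

end

section \<open>Being on the wrong side of zero for the drift\<close>

text \<open>The existential quantifier ranges over uncountably many times. By compactness and continuity it
holds iff for every \<open>n\<close> some time in a fixed countable dense set has value below \<open>1 / (n + 1)\<close>,
which is a countable combination of events.\<close>

lemma measurable_exists_nonpos:
  fixes f :: "real \<Rightarrow> 'a \<Rightarrow> real"
  assumes K: "compact K"
    and rv: "\<And>s. s \<in> K \<Longrightarrow> f s \<in> borel_measurable M"
    and cont: "\<And>\<omega>. \<omega> \<in> space M \<Longrightarrow> continuous_on K (\<lambda>s. f s \<omega>)"
  shows "{\<omega>\<in>space M. \<exists>s\<in>K. f s \<omega> \<le> 0} \<in> sets M"
proof -
  obtain D where D: "countable D" "D \<subseteq> K" "K \<subseteq> closure D"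
    using separable by metis
  have *: "(\<exists>s\<in>K. f s \<omega> \<le> 0) \<longleftrightarrow> (\<forall>n::nat. \<exists>d\<in>D. f d \<omega> < 1 / real (Suc n))"
    if \<omega>: "\<omega> \<in> space M" for \<omega>
  proof
    assume "\<exists>s\<in>K. f s \<omega> \<le> 0"
    then obtain s where s: "s \<in> K" "f s \<omega> \<le> 0" by blast
    show "\<forall>n. \<exists>d\<in>D. f d \<omega> < 1 / real (Suc n)"
    proof
      fix n
      have "\<exists>\<delta>>0. \<forall>x\<in>K. dist x s < \<delta> \<longrightarrow> dist (f x \<omega>) (f s \<omega>) < 1 / real (Suc n)"
        using cont[OF \<omega>] s(1) unfolding continuous_on_iff by force
      then obtain \<delta> where \<delta>: "\<delta> > 0"
        "\<And>x. x \<in> K \<Longrightarrow> dist x s < \<delta> \<Longrightarrow> dist (f x \<omega>) (f s \<omega>) < 1 / real (Suc n)"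
        by blast
      obtain d where d: "d \<in> D" "dist d s < \<delta>"
        using D(3) s(1) \<delta>(1) by (meson closure_approachable subsetD)
      then have "dist (f d \<omega>) (f s \<omega>) < 1 / real (Suc n)" using D(2) \<delta>(2) by blast
      then show "\<exists>d\<in>D. f d \<omega> < 1 / real (Suc n)"
        using d s(2) by (intro bexI[of _ d]) (auto simp: dist_real_def)
    qed
  next
    assume R: "\<forall>n. \<exists>d\<in>D. f d \<omega> < 1 / real (Suc n)"
    then have "K \<noteq> {}" using D(2) by blast
    then obtain s where s: "s \<in> K" "\<And>x. x \<in> K \<Longrightarrow> f s \<omega> \<le> f x \<omega>"
      using continuous_attains_inf[OF K _ cont[OF \<omega>]] by blast
    have "f s \<omega> \<le> 1 / real (Suc n)" for n
      using R D(2) s(2) by (meson less_imp_le order.trans subsetD)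
    then have "f s \<omega> \<le> 0"
      by (meson not_le nat_approx_posE less_le_not_le)
    then show "\<exists>s\<in>K. f s \<omega> \<le> 0" using s(1) by blast
  qed
  have "{\<omega>\<in>space M. \<exists>s\<in>K. f s \<omega> \<le> 0} =
      {\<omega>\<in>space M. \<forall>n::nat. \<exists>d\<in>D. f d \<omega> < 1 / real (Suc n)}"
    using * by blast
  also have "\<dots> \<in> sets M"
  proof -
    have "Measurable.pred M (\<lambda>\<omega>. f d \<omega> < 1 / real (Suc n))" if "d \<in> D" for d n
    proof -
      have [measurable]: "f d \<in> borel_measurable M" using rv D(2) that by blast
      show ?thesis by measurable
    qed
    then show ?thesis
      using D(1) by (intro predE pred_intros_countable pred_intros_countable_bounded) auto
  qed
  finally show ?thesis .
qed

context standard_brownian_motion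
begin

lemma measurable_with_drift: "s \<ge> 0 \<Longrightarrow> with_drift B \<nu> s \<in> borel_measurable M"
  using rv unfolding with_drift_def by (intro borel_measurable_add) auto

lemma continuous_with_drift:
  "\<omega> \<in> space M \<Longrightarrow> continuous_on {0..} (\<lambda>s. with_drift B \<nu> s \<omega>)"
  unfolding with_drift_def by (intro continuous_intros continuous_paths)

lemma measurable_against_drift:
  assumes "0 \<le> a"
  shows "{\<omega>\<in>space M. \<exists>s\<in>{a..t}. \<nu> * with_drift B \<nu> s \<omega> \<le> 0} \<in> sets M"
proof (rule measurable_exists_nonpos)
  fix \<omega> assume "\<omega> \<in> space M"
  then show "continuous_on {a..t} (\<lambda>s. \<nu> * with_drift B \<nu> s \<omega>)"
    using assms by (intro continuous_intros continuous_on_subset[OF continuous_with_drift]) auto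
qed (use measurable_with_drift assms in \<open>auto intro!: borel_measurable_times\<close>)

text \<open>At a time \<open>s \<ge> a\<close> with \<open>\<nu> * with_drift B \<nu> s \<omega> \<le> 0\<close> the exponential martingale with parameter
\<open>- \<nu>\<close> is at least \<open>exp (\<nu>\<^sup>2 * a / 2)\<close>. The maximal inequality asks for a strict crossing, so it
is applied below this level.\<close>

lemma prob_against_drift_after_le:
  assumes "0 \<le> a" "a \<le> t" "t > 0"
  shows "prob {\<omega>\<in>space M. \<exists>s\<in>{a..t}. \<nu> * with_drift B \<nu> s \<omega> \<le> 0} \<le> exp (- (\<nu>\<^sup>2 * a / 2))"
proof -
  let ?E = "{\<omega>\<in>space M. \<exists>s\<in>{a..t}. \<nu> * with_drift B \<nu> s \<omega> \<le> 0}"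
  have E: "?E \<in> sets M" using assms(1) by (rule measurable_against_drift)
  have bound: "prob ?E \<le> 1 / c" if c: "0 < c" "c < exp (\<nu>\<^sup>2 * a / 2)" for c
  proof (rule exp_martingale_maximal[OF assms(3) c(1) E, of "- \<nu>"])
    fix \<omega> assume "\<omega> \<in> ?E"
    then obtain s where s: "s \<in> {a..t}" "\<nu> * with_drift B \<nu> s \<omega> \<le> 0" by blast
    have "\<nu>\<^sup>2 * a \<le> \<nu>\<^sup>2 * s" using s(1) by (intro mult_left_mono) auto
    then have "\<nu>\<^sup>2 * a / 2 \<le> - \<nu> * B s \<omega> - (- \<nu>)\<^sup>2 * s / 2"
      using s(2) by (simp add: with_drift_def algebra_simps power2_eq_square)
    then have "c < exp (- \<nu> * B s \<omega> - (- \<nu>)\<^sup>2 * s / 2)"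
      using c(2) by (meson exp_le_cancel_iff less_le_trans)
    then show "\<exists>s\<in>{0..t}. c < exp (- \<nu> * B s \<omega> - (- \<nu>)\<^sup>2 * s / 2)"
      using s(1) assms(1) by (intro bexI[of _ s]) auto
  qed
  have "exp (\<nu>\<^sup>2 * a / 2) \<le> 1 / prob ?E" if "prob ?E > 0"
  proof (rule dense_le_bounded[of 0])
    fix c assume "0 < c" "c < exp (\<nu>\<^sup>2 * a / 2)"
    then show "c \<le> 1 / prob ?E" using bound[of c] that by (simp add: field_simps)
  qed simp
  then show ?thesis
    by (cases "prob ?E = 0") (simp_all add: exp_minus field_simps zero_less_measure_iff)
qed

text \<open>For nonzero \<open>\<nu>\<close> and \<open>a\<close> the variable \<open>- \<nu> * B a / (\<bar>\<nu>\<bar> * sqrt a)\<close> is standard normal, and the event says that it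
is at least \<open>\<bar>\<nu>\<bar> * sqrt a\<close>. The mass of the unit interval above this threshold already has the
right exponential order, and the bound so obtained remains true at \<open>a = 0\<close>, where the event is certain.\<close>

lemma prob_against_drift_ge:
  assumes "0 \<le> a"
  shows "exp (- ((\<bar>\<nu>\<bar> * sqrt a + 1)\<^sup>2 / 2)) / sqrt (2 * pi)
    \<le> prob {\<omega>\<in>space M. \<nu> * with_drift B \<nu> a \<omega> \<le> 0}"
proof (cases "\<nu> = 0 \<or> a = 0")
  case True
  then have "{\<omega>\<in>space M. \<nu> * with_drift B \<nu> a \<omega> \<le> 0} = space M"
    using start by (auto simp: with_drift_def)
  moreover have "exp (- ((\<bar>\<nu>\<bar> * sqrt a + 1)\<^sup>2 / 2)) \<le> sqrt (2 * pi)"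
    by (rule order.trans[of _ 1]) (use pi_gt3 in auto)
  ultimately show ?thesis by (simp add: prob_space)
next
  case False
  then have a: "a > 0" and \<nu>: "\<nu> \<noteq> 0" using assms by auto
  let ?\<sigma> = "\<bar>\<nu>\<bar> * sqrt a"
  define z where "z = ?\<sigma>"
  have z: "z > 0" using a \<nu> by (simp add: z_def)
  define Z where "Z = (\<lambda>\<omega>. 0 + (- \<nu> / z) * (B a \<omega> - B 0 \<omega>))"
  have "distributed M lborel Z (normal_density (0 + (- \<nu> / z) * 0) (\<bar>- \<nu> / z\<bar> * sqrt (a - 0)))"
    unfolding Z_def using a \<nu> z by (intro normal_density_affine normal_increments) auto
  moreover have "\<bar>- \<nu> / z\<bar> * sqrt (a - 0) = 1"
    using a \<nu> by (simp add: z_def abs_mult)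
  ultimately have D: "distributed M lborel Z std_normal_density"
    by (simp only: mult_zero_right add_0_left)
  have Z_iff: "\<nu> * with_drift B \<nu> a \<omega> \<le> 0 \<longleftrightarrow> z \<le> Z \<omega>" if "\<omega> \<in> space M" for \<omega>
  proof -
    have "z \<le> Z \<omega> \<longleftrightarrow> z * z \<le> - (\<nu> * B a \<omega>)"
      using z start[OF that] by (simp add: Z_def field_simps)
    also have "z * z = \<nu>\<^sup>2 * a" using a by (simp add: z_def power_mult_distrib flip: power2_eq_square)
    also have "\<nu>\<^sup>2 * a \<le> - (\<nu> * B a \<omega>) \<longleftrightarrow> \<nu> * with_drift B \<nu> a \<omega> \<le> 0"
      by (auto simp: with_drift_def distrib_left power2_eq_square mult.assoc)
    finally show ?thesis by blast
  qed
  let ?d = "exp (- ((z + 1)\<^sup>2 / 2)) / sqrt (2 * pi)"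
  have "ennreal ?d = (\<integral>\<^sup>+x. ennreal ?d * indicator {z..z+1} x \<partial>lborel)"
    by (simp add: nn_integral_cmult)
  also have "\<dots> \<le> (\<integral>\<^sup>+x. ennreal (std_normal_density x) * indicator {z..z+1} x \<partial>lborel)"
  proof (rule nn_integral_mono)
    fix x
    have "?d \<le> std_normal_density x" if "x \<in> {z..z+1}"
    proof -
      have "x\<^sup>2 \<le> (z + 1)\<^sup>2" using that z by (intro power_mono) auto
      then show ?thesis by (simp add: std_normal_density_def divide_right_mono)
    qed
    then show "ennreal ?d * indicator {z..z+1} x \<le> ennreal (std_normal_density x) * indicator {z..z+1} x"
      by (auto simp: indicator_def intro: ennreal_leI)
  qed
  also have "\<dots> = emeasure M (Z -` {z..z+1} \<inter> space M)"
    using distributed_emeasure[OF D, of "{z..z+1}"] by simp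
  finally have "?d \<le> prob (Z -` {z..z+1} \<inter> space M)"
    by (simp add: emeasure_eq_measure)
  also have "\<dots> \<le> prob {\<omega>\<in>space M. \<nu> * with_drift B \<nu> a \<omega> \<le> 0}"
    using Z_iff assms by (intro finite_measure_mono) (auto intro!: measurable_with_drift borel_measurable_le borel_measurable_times)
  finally show ?thesis by (simp add: z_def)
qed

end

section \<open>The last zero\<close>

lemma last_zero_attained:
  assumes "continuous_on {0..t} (\<lambda>s. X s \<omega>)" "X 0 \<omega> = 0" "0 \<le> t"
  shows "last_zero X t \<omega> \<in> {0..t}" "X (last_zero X t \<omega>) \<omega> = 0"
proof -
  let ?S = "{s \<in> {0..t}. X s \<omega> = 0}"
  have "closed ?S"
    using assms(1) by (intro continuous_closed_preimage_constant) auto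
  moreover have "0 \<in> ?S" using assms by auto
  moreover have "bdd_above ?S" by (auto intro: bdd_aboveI[of _ t])
  ultimately have "Sup ?S \<in> ?S" by (intro closed_contains_Sup) auto
  then show "last_zero X t \<omega> \<in> {0..t}" "X (last_zero X t \<omega>) \<omega> = 0"
    by (auto simp: last_zero_def)
qed

text \<open>Characterises the last zero by events of the form handled above. The maximum with 0 allows any
real threshold, as measurability requires.\<close>

lemma le_last_zero_iff:
  assumes "continuous_on {0..t} (\<lambda>s. X s \<omega>)" "X 0 \<omega> = 0" "0 \<le> t"
  shows "a \<le> last_zero X t \<omega> \<longleftrightarrow> (\<exists>s\<in>{max 0 a..t}. X s \<omega> = 0)"
proof
  assume "a \<le> last_zero X t \<omega>"
  then show "\<exists>s\<in>{max 0 a..t}. X s \<omega> = 0"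
    using last_zero_attained[of t X \<omega>] assms by (intro bexI[of _ "last_zero X t \<omega>"]) auto
next
  assume "\<exists>s\<in>{max 0 a..t}. X s \<omega> = 0"
  then obtain s where s: "s \<in> {max 0 a..t}" "X s \<omega> = 0" by blast
  then have "s \<le> last_zero X t \<omega>"
    unfolding last_zero_def by (intro cSup_upper) (auto intro: bdd_aboveI[of _ t])
  then show "a \<le> last_zero X t \<omega>" using s(1) by simp
qed

context standard_brownian_motion
begin

lemma with_drift_start: "\<omega> \<in> space M \<Longrightarrow> with_drift B \<nu> 0 \<omega> = 0"
  using start by (simp add: with_drift_def)

lemma continuous_with_drift_on:
  "\<omega> \<in> space M \<Longrightarrow> 0 \<le> a \<Longrightarrow> continuous_on {a..t} (\<lambda>s. with_drift B \<nu> s \<omega>)"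
  by (rule continuous_on_subset[OF continuous_with_drift]) auto

lemma measurable_last_zero:
  assumes "t \<ge> 0"
  shows "last_zero (with_drift B \<nu>) t \<in> borel_measurable M"
  unfolding borel_measurable_iff_ge
proof
  fix a
  have "{\<omega>\<in>space M. \<exists>s\<in>{max 0 a..t}. \<bar>with_drift B \<nu> s \<omega>\<bar> \<le> 0} \<in> sets M"
    by (rule measurable_exists_nonpos)
       (auto intro!: continuous_intros continuous_with_drift_on borel_measurable_abs measurable_with_drift)
  also have "{\<omega>\<in>space M. \<exists>s\<in>{max 0 a..t}. \<bar>with_drift B \<nu> s \<omega>\<bar> \<le> 0} =
      {\<omega>\<in>space M. a \<le> last_zero (with_drift B \<nu>) t \<omega>}"
    using assms
    by (intro Collect_cong conj_cong refl)
       (subst le_last_zero_iff, auto intro: continuous_with_drift_on with_drift_start)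
  finally show "{\<omega>\<in>space M. a \<le> last_zero (with_drift B \<nu>) t \<omega>} \<in> sets M" .
qed

lemma prob_last_zero_ge_le:
  assumes "0 \<le> a" "t > 0"
  shows "prob {\<omega>\<in>space M. a \<le> last_zero (with_drift B \<nu>) t \<omega>} \<le> exp (- (\<nu>\<^sup>2 * a / 2))"
proof (cases "a \<le> t")
  case True
  have "{\<omega>\<in>space M. a \<le> last_zero (with_drift B \<nu>) t \<omega>} \<subseteq>
      {\<omega>\<in>space M. \<exists>s\<in>{a..t}. \<nu> * with_drift B \<nu> s \<omega> \<le> 0}"
  proof (intro Collect_mono impI; elim conjE)
    fix \<omega> assume \<omega>: "\<omega> \<in> space M" and "a \<le> last_zero (with_drift B \<nu>) t \<omega>"
    then have "\<exists>s\<in>{max 0 a..t}. with_drift B \<nu> s \<omega> = 0"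
      using assms by (subst (asm) le_last_zero_iff) (auto intro: continuous_with_drift_on with_drift_start)
    then obtain s where "s \<in> {a..t}" "with_drift B \<nu> s \<omega> = 0" by auto
    then show "\<omega> \<in> space M \<and> (\<exists>s\<in>{a..t}. \<nu> * with_drift B \<nu> s \<omega> \<le> 0)"
      using \<omega> by (auto intro!: bexI[of _ s])
  qed
  then have "prob {\<omega>\<in>space M. a \<le> last_zero (with_drift B \<nu>) t \<omega>} \<le>
      prob {\<omega>\<in>space M. \<exists>s\<in>{a..t}. \<nu> * with_drift B \<nu> s \<omega> \<le> 0}"
    using assms by (intro finite_measure_mono measurable_against_drift) auto
  also have "\<dots> \<le> exp (- (\<nu>\<^sup>2 * a / 2))"
    using True assms by (intro prob_against_drift_after_le)
  finally show ?thesis .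
next
  case False
  then have "{\<omega>\<in>space M. a \<le> last_zero (with_drift B \<nu>) t \<omega>} = {}"
    using assms by (auto simp: le_last_zero_iff continuous_with_drift_on with_drift_start)
  then show ?thesis by (simp only: measure_empty exp_ge_zero)
qed

text \<open>A path that is against its drift at time \<open>a\<close> and strictly with it during all of \<open>[b, t]\<close>
has a zero in \<open>[a, b)\<close> and none from \<open>b\<close> on.\<close>

lemma prob_last_zero_between_ge:
  assumes "0 \<le> a" "a < b" "b \<le> t"
  shows "exp (- ((\<bar>\<nu>\<bar> * sqrt a + 1)\<^sup>2 / 2)) / sqrt (2 * pi) - exp (- (\<nu>\<^sup>2 * b / 2))
    \<le> prob {\<omega>\<in>space M. a \<le> last_zero (with_drift B \<nu>) t \<omega> \<and> last_zero (with_drift B \<nu>) t \<omega> < b}"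
proof -
  let ?X = "with_drift B \<nu>"
  let ?A = "{\<omega>\<in>space M. \<nu> * ?X a \<omega> \<le> 0}"
  let ?E = "{\<omega>\<in>space M. \<exists>s\<in>{b..t}. \<nu> * ?X s \<omega> \<le> 0}"
  let ?T = "last_zero ?X t"
  have t: "t > 0" "0 \<le> b" using assms by auto
  have sub: "?A - ?E \<subseteq> {\<omega>\<in>space M. a \<le> ?T \<omega> \<and> ?T \<omega> < b}"
  proof
    fix \<omega> assume "\<omega> \<in> ?A - ?E"
    then have \<omega>: "\<omega> \<in> space M" and A: "\<nu> * ?X a \<omega> \<le> 0"
      and pos: "\<And>s. s \<in> {b..t} \<Longrightarrow> 0 < \<nu> * ?X s \<omega>"
      by (auto simp: not_le)
    have "0 < \<nu> * ?X b \<omega>" using assms by (intro pos) auto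
    then have \<nu>: "\<nu> \<noteq> 0" by auto
    have iff: "c \<le> ?T \<omega> \<longleftrightarrow> (\<exists>s\<in>{max 0 c..t}. ?X s \<omega> = 0)" for c
      using \<omega> t by (intro le_last_zero_iff continuous_with_drift_on with_drift_start) auto
    have "\<exists>s\<ge>a. s \<le> b \<and> \<nu> * ?X s \<omega> = 0"
      using assms A pos[of b]
      by (intro IVT' continuous_intros continuous_with_drift_on \<omega>) auto
    then obtain s where "s \<in> {a..b}" "?X s \<omega> = 0" using \<nu> by auto
    then have "a \<le> ?T \<omega>" unfolding iff using assms by (intro bexI[of _ s]) auto
    moreover have "\<not> b \<le> ?T \<omega>" unfolding iff using t(2) pos by fastforce
    ultimately show "\<omega> \<in> {\<omega>\<in>space M. a \<le> ?T \<omega> \<and> ?T \<omega> < b}" using \<omega> by simp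
  qed
  have [measurable]: "?T \<in> borel_measurable M" using t by (intro measurable_last_zero) auto
  have E: "?E \<in> sets M" using t(2) by (rule measurable_against_drift)
  have [measurable]: "?X a \<in> borel_measurable M" by (rule measurable_with_drift[OF assms(1)])
  have A: "?A \<in> sets M" by measurable
  have "prob ?A \<le> prob ((?A - ?E) \<union> ?E)"
    by (rule finite_measure_mono) (use A E in blast)+
  also have "\<dots> \<le> prob (?A - ?E) + prob ?E"
    using A E by (intro measure_Un_le sets.Diff)
  also have "prob (?A - ?E) \<le> prob {\<omega>\<in>space M. a \<le> ?T \<omega> \<and> ?T \<omega> < b}"
    by (intro finite_measure_mono sub) measurable
  also have "prob ?E \<le> exp (- (\<nu>\<^sup>2 * b / 2))"
    using assms t by (intro prob_against_drift_after_le)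
  finally show ?thesis using prob_against_drift_ge[OF assms(1), of \<nu>] by simp
qed

text \<open>In the scaling of the large deviation principle, with \<open>\<nu> = \<mu> * sqrt r\<close> and time unit
\<open>1 / (r * g)\<close>, the parameter \<open>r\<close> cancels from both bounds and only \<open>g\<close> remains.\<close>

lemma prob_scaled_last_zero_ge_le:
  assumes "0 \<le> w" "t > 0" "r > 0" "g > 0"
  shows "prob {\<omega>\<in>space M. w \<le> r * g * last_zero (with_drift B (\<mu> * sqrt r)) t \<omega>}
    \<le> exp (- (\<mu>\<^sup>2 / 2 * w) / g)"
proof -
  have "{\<omega>\<in>space M. w \<le> r * g * last_zero (with_drift B (\<mu> * sqrt r)) t \<omega>} =
      {\<omega>\<in>space M. w / (r * g) \<le> last_zero (with_drift B (\<mu> * sqrt r)) t \<omega>}"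
    using assms by (auto simp: field_simps)
  also have "prob \<dots> \<le> exp (- ((\<mu> * sqrt r)\<^sup>2 * (w / (r * g)) / 2))"
    using assms by (intro prob_last_zero_ge_le) auto
  also have "(\<mu> * sqrt r)\<^sup>2 * (w / (r * g)) / 2 = \<mu>\<^sup>2 / 2 * w / g"
    using assms by (simp add: power_mult_distrib)
  finally show ?thesis by simp
qed

lemma prob_scaled_last_zero_between_ge:
  assumes "0 \<le> w" "w < b" "b \<le> t * (r * g)" "r > 0" "g > 0"
  shows "exp (- ((\<bar>\<mu>\<bar> * sqrt w / sqrt g + 1)\<^sup>2 / 2)) / sqrt (2 * pi) - exp (- (\<mu>\<^sup>2 / 2 * b) / g)
    \<le> prob {\<omega>\<in>space M. w \<le> r * g * last_zero (with_drift B (\<mu> * sqrt r)) t \<omega> \<and>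
                  r * g * last_zero (with_drift B (\<mu> * sqrt r)) t \<omega> < b}"
proof -
  let ?T = "last_zero (with_drift B (\<mu> * sqrt r)) t"
  have "exp (- ((\<bar>\<mu> * sqrt r\<bar> * sqrt (w / (r * g)) + 1)\<^sup>2 / 2)) / sqrt (2 * pi)
        - exp (- ((\<mu> * sqrt r)\<^sup>2 * (b / (r * g)) / 2))
      \<le> prob {\<omega>\<in>space M. w / (r * g) \<le> ?T \<omega> \<and> ?T \<omega> < b / (r * g)}"
    using assms by (intro prob_last_zero_between_ge) (auto simp: field_simps)
  also have "{\<omega>\<in>space M. w / (r * g) \<le> ?T \<omega> \<and> ?T \<omega> < b / (r * g)} =
      {\<omega>\<in>space M. w \<le> r * g * ?T \<omega> \<and> r * g * ?T \<omega> < b}"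
    using assms by (auto simp: field_simps)
  also have "\<bar>\<mu> * sqrt r\<bar> * sqrt (w / (r * g)) = \<bar>\<mu>\<bar> * sqrt w / sqrt g"
    using assms by (simp add: abs_mult real_sqrt_divide real_sqrt_mult)
  also have "(\<mu> * sqrt r)\<^sup>2 * (b / (r * g)) / 2 = \<mu>\<^sup>2 / 2 * b / g"
    using assms by (simp add: power_mult_distrib)
  finally show ?thesis by simp
qed

end

section \<open>The large deviation principle\<close>

lemma log_prob_mono:
  assumes "0 \<le> p" "p \<le> q"
  shows "log_prob p \<le> log_prob q"
  using assms by (auto simp: log_prob_def)

text \<open>The factor \<open>1 / (1 / g)\<close> is the reciprocal of the speed \<open>1 / g\<close>.\<close>

lemma scaled_log_prob_le:
  assumes "0 \<le> p" "p \<le> exp (- m / g)" "g > 0"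
  shows "ereal (1 / (1 / g)) * log_prob p \<le> ereal (- m)"
proof -
  have "ereal (1 / (1 / g)) * log_prob p \<le> ereal (1 / (1 / g)) * log_prob (exp (- m / g))"
    using assms by (intro ereal_mult_left_mono log_prob_mono) auto
  also have "\<dots> = ereal (- m)" using assms by (simp add: log_prob_def)
  finally show ?thesis .
qed

lemma scaled_log_prob_ge:
  assumes "exp (- m / g) \<le> p" "g > 0"
  shows "ereal (- m) \<le> ereal (1 / (1 / g)) * log_prob p"
proof -
  have "ereal (- m) = ereal (1 / (1 / g)) * log_prob (exp (- m / g))"
    using assms by (simp add: log_prob_def)
  also have "\<dots> \<le> ereal (1 / (1 / g)) * log_prob p"
    using assms by (intro ereal_mult_left_mono log_prob_mono) auto
  finally show ?thesis .
qed

text \<open>The two terms of the lower estimate for the last zero, with \<open>m\<^sup>2 / 2\<close> and \<open>k\<close> the rates at the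
two ends of the interval. The number \<open>L\<close> is chosen such that \<open>exp (- L / g)\<close> is exactly
half of the Gaussian term; it tends to \<open>m\<^sup>2 / 2\<close> as \<open>g \<rightarrow> 0\<close>, hence it is eventually below \<open>k\<close>
when \<open>m\<^sup>2 / 2 < k\<close>.\<close>

lemma gaussian_tail_dominates:
  fixes m k g :: real
  defines "L \<equiv> (m + sqrt g)\<^sup>2 / 2 + g * ln (2 * sqrt (2 * pi))"
  assumes "g > 0" "L \<le> k"
  shows "exp (- L / g) \<le> exp (- ((m / sqrt g + 1)\<^sup>2 / 2)) / sqrt (2 * pi) - exp (- k / g)"
proof -
  have "(m + sqrt g)\<^sup>2 / 2 / g = (m / sqrt g + 1)\<^sup>2 / 2"
  proof -
    have "(m + sqrt g)\<^sup>2 / g = ((m + sqrt g) / sqrt g)\<^sup>2"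
      using assms(2) by (simp add: power_divide)
    also have "(m + sqrt g) / sqrt g = m / sqrt g + 1"
      using assms(2) by (simp add: add_divide_distrib)
    finally show ?thesis by simp
  qed
  moreover have "L / g = (m + sqrt g)\<^sup>2 / 2 / g + ln (2 * sqrt (2 * pi))"
    using assms(2) unfolding L_def add_divide_distrib by simp
  ultimately have L: "- L / g = - ((m / sqrt g + 1)\<^sup>2 / 2) - ln (2 * sqrt (2 * pi))"
    by (simp only: minus_divide_left[symmetric])
  have pos: "0 < 2 * sqrt (2 * pi)" by simp
  have "2 * exp (- L / g) = 2 * (exp (- ((m / sqrt g + 1)\<^sup>2 / 2)) / (2 * sqrt (2 * pi)))"
    by (simp only: L exp_diff exp_ln[OF pos])
  then have "2 * exp (- L / g) = exp (- ((m / sqrt g + 1)\<^sup>2 / 2)) / sqrt (2 * pi)"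
    by simp
  moreover have "exp (- k / g) \<le> exp (- L / g)"
    using assms(2,3) by (simp add: divide_right_mono)
  ultimately show ?thesis by linarith
qed

theorem proposition2p2:
  fixes \<mu> t :: real and \<gamma> :: "real \<Rightarrow> real"
    and M :: "real \<Rightarrow> 'a measure" and B :: "real \<Rightarrow> real \<Rightarrow> 'a \<Rightarrow> real"
  assumes "\<mu> \<noteq> 0" and "t > 0"
    and "\<And>r. r > 0 \<Longrightarrow> standard_brownian_motion (M r) (B r)"
    and "\<And>r. r > 0 \<Longrightarrow> \<gamma> r > 0"
    and "(\<gamma> \<longlongrightarrow> 0) at_top"
    and "filterlim (\<lambda>r. r * \<gamma> r) at_top at_top"
  defines "J \<equiv> \<lambda>b::real. if b \<ge> 0 then ereal (\<mu>\<^sup>2 / 2 * b) else \<infinity>"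
  shows "large_deviation_principle M
           (\<lambda>r \<omega>. r * \<gamma> r * last_zero (with_drift (B r) (\<mu> * sqrt r)) t \<omega>)
           (\<lambda>r. 1 / \<gamma> r) J
         \<and> good_rate_function J"
proof -
  define W where "W = (\<lambda>r \<omega>. r * \<gamma> r * last_zero (with_drift (B r) (\<mu> * sqrt r)) t \<omega>)"
  define P where "P = (\<lambda>r S. measure (M r) {\<omega> \<in> space (M r). W r \<omega> \<in> S})"
  have \<mu>2: "\<mu>\<^sup>2 / 2 > 0" using \<open>\<mu> \<noteq> 0\<close> by simp
  have prob: "prob_space (M r)" if "r > 0" for r
    using assms(3)[OF that] unfolding standard_brownian_motion_def by blast
  have W_meas: "W r \<in> borel_measurable (M r)" if "r > 0" for r
    unfolding W_def using standard_brownian_motion.measurable_last_zero[OF assms(3)[OF that]] \<open>t > 0\<close>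
    by (intro borel_measurable_times) auto
  \<comment> \<open>\<open>W r\<close> is nonnegative, so only the nonnegative part of a set matters.\<close>
  have P_mono: "P r S \<le> P r S'" if "r > 0" "S' \<in> sets borel" "S \<inter> {0..} \<subseteq> S'" for r S S'
  proof -
    interpret standard_brownian_motion "M r" "B r" by (rule assms(3)[OF that(1)])
    have "W r \<omega> \<ge> 0" if "\<omega> \<in> space (M r)" for \<omega>
    proof -
      have "last_zero (with_drift (B r) (\<mu> * sqrt r)) t \<omega> \<in> {0..t}"
        using that \<open>t > 0\<close>
        by (intro last_zero_attained(1) continuous_with_drift_on with_drift_start) auto
      then show ?thesis using \<open>r > 0\<close> assms(4)[OF \<open>r > 0\<close>] by (simp add: W_def)
    qed
    then show ?thesis
      unfolding P_def using that(3) measurable_sets_Collect[OF W_meas[OF that(1)], of "\<lambda>x. x \<in> S'"] that(2)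
      by (intro finite_measure_mono) auto
  qed
  have speed: "filterlim (\<lambda>r. 1 / \<gamma> r) at_top at_top"
    unfolding inverse_eq_divide[symmetric]
    using assms(4,5) by (intro filterlim_inverse_at_top eventually_at_top_linorderI[of 1]) auto
  have lsc: "lower_semicontinuous J"
    unfolding lower_semicontinuous_def
  proof
    fix x
    show "J x \<le> Liminf (at x) J"
    proof (cases "x \<ge> 0")
      case True
      have "((\<lambda>y. ereal (\<mu>\<^sup>2 / 2 * y)) \<longlongrightarrow> J x) (at x)"
        using True unfolding J_def by (auto intro!: tendsto_intros)
      then have "J x = Liminf (at x) (\<lambda>y. ereal (\<mu>\<^sup>2 / 2 * y))"
        by (simp add: lim_imp_Liminf)
      also have "\<dots> \<le> Liminf (at x) J"
        by (intro Liminf_mono always_eventually) (auto simp: J_def)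
      finally show ?thesis .
    next
      case False
      then have "\<forall>\<^sub>F y in at x. y < 0"
        by (intro order_tendstoD[OF tendsto_ident_at]) auto
      then have "\<forall>\<^sub>F y in at x. J x \<le> J y"
        by eventually_elim (auto simp: J_def)
      then show ?thesis by (rule Liminf_bounded)
    qed
  qed
  have upper: "Limsup at_top (\<lambda>r. ereal (1 / (1 / \<gamma> r)) * log_prob (P r C)) \<le> - (INF w\<in>C. J w)" for C
  proof (cases "C \<inter> {0..} = {}")
    case True
    have "ereal (1 / (1 / \<gamma> r)) * log_prob (P r C) \<le> - (INF w\<in>C. J w)" if "r > 0" for r
    proof -
      have "P r C = 0"
        using P_mono[OF that, of "{}" C] True by (simp add: P_def measure_le_0_iff)
      then show ?thesis using assms(4)[OF that] by (simp add: log_prob_def)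
    qed
    then have "\<forall>\<^sub>F r in at_top. ereal (1 / (1 / \<gamma> r)) * log_prob (P r C) \<le> - (INF w\<in>C. J w)"
      by (intro eventually_at_top_linorderI[of 1]) auto
    then show ?thesis by (rule Limsup_bounded)
  next
    case False
    then obtain w0 where w0: "w0 \<in> C" "w0 \<ge> 0" by auto
    have "(INF w\<in>C. J w) \<le> J w0" using w0 by (intro INF_lower)
    moreover have "0 \<le> (INF w\<in>C. J w)"
      using \<mu>2 by (intro INF_greatest) (auto simp: J_def)
    ultimately obtain m where m: "(INF w\<in>C. J w) = ereal m" "m \<ge> 0"
      using w0 by (cases "INF w\<in>C. J w") (auto simp: J_def)
    \<comment> \<open>\<open>c\<close> is the point whose rate is \<open>m\<close>; as the rate increases on \<open>{0..}\<close>, no nonnegative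
      point of \<open>C\<close> lies below it.\<close>
    define c where "c = m / (\<mu>\<^sup>2 / 2)"
    have c: "c \<ge> 0" "\<mu>\<^sup>2 / 2 * c = m" using m(2) \<mu>2 by (auto simp: c_def)
    have "C \<inter> {0..} \<subseteq> {c..}"
    proof
      fix w assume w: "w \<in> C \<inter> {0..}"
      then have "ereal m \<le> J w" unfolding m(1)[symmetric] by (intro INF_lower) auto
      then show "w \<in> {c..}" using w \<mu>2 by (auto simp: J_def c_def field_simps)
    qed
    have "ereal (1 / (1 / \<gamma> r)) * log_prob (P r C) \<le> ereal (- m)" if "r > 0" for r
    proof (rule scaled_log_prob_le)
      have "P r C \<le> P r {c..}" by (rule P_mono) (use that \<open>C \<inter> {0..} \<subseteq> {c..}\<close> in auto)
      also have "\<dots> \<le> exp (- m / \<gamma> r)"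
        using standard_brownian_motion.prob_scaled_last_zero_ge_le[OF assms(3)[OF that] c(1) assms(2) that assms(4)[OF that], of \<mu>]
        unfolding c(2) P_def W_def by simp
      finally show "P r C \<le> exp (- m / \<gamma> r)" .
    qed (use assms(4)[OF that] in \<open>auto simp: P_def\<close>)
    then have "\<forall>\<^sub>F r in at_top. ereal (1 / (1 / \<gamma> r)) * log_prob (P r C) \<le> - (INF w\<in>C. J w)"
      unfolding m(1) by (intro eventually_at_top_linorderI[of 1]) auto
    then show ?thesis by (rule Limsup_bounded)
  qed
  have lower: "- (INF w\<in>G. J w) \<le> Liminf at_top (\<lambda>r. ereal (1 / (1 / \<gamma> r)) * log_prob (P r G))"
    (is "_ \<le> ?lim") if "open G" for G
  proof -
    have "- J w \<le> ?lim" if w: "w \<in> G" for w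
    proof (cases "w \<ge> 0")
      case True
      obtain e where e: "e > 0" "ball w e \<subseteq> G"
        using \<open>open G\<close> w open_contains_ball by blast
      define b where "b = w + e"
      have sub: "{w..<b} \<subseteq> G"
        using e(2) by (auto simp: b_def dist_real_def subset_iff)
      define m where "m = \<bar>\<mu>\<bar> * sqrt w"
      define L where "L = (\<lambda>g. (m + sqrt g)\<^sup>2 / 2 + g * ln (2 * sqrt (2 * pi)))"
      have m2: "m\<^sup>2 / 2 = \<mu>\<^sup>2 / 2 * w" using True by (simp add: m_def power_mult_distrib)
      \<comment> \<open>\<open>L\<close> is continuous at 0.\<close>
      have "((\<lambda>r. L (\<gamma> r)) \<longlongrightarrow> (m + sqrt 0)\<^sup>2 / 2 + 0 * ln (2 * sqrt (2 * pi))) at_top"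
        unfolding L_def by (intro tendsto_intros assms(5)) simp
      then have L: "((\<lambda>r. L (\<gamma> r)) \<longlongrightarrow> \<mu>\<^sup>2 / 2 * w) at_top"
        using m2 by simp
      have "\<mu>\<^sup>2 / 2 * w < \<mu>\<^sup>2 / 2 * b"
        using \<mu>2 e(1) by (intro mult_strict_left_mono) (auto simp: b_def)
      with L have "\<forall>\<^sub>F r in at_top. L (\<gamma> r) < \<mu>\<^sup>2 / 2 * b" by (rule order_tendstoD)
      moreover have "\<forall>\<^sub>F r in at_top. b / t \<le> r * \<gamma> r"
        using assms(6) by (simp add: filterlim_at_top)
      ultimately have ev: "\<forall>\<^sub>F r in at_top.
          ereal (- L (\<gamma> r)) \<le> ereal (1 / (1 / \<gamma> r)) * log_prob (P r G)"
        using eventually_gt_at_top[of 0]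
      proof eventually_elim
        case (elim r)
        note \<gamma> = assms(4)[OF elim(3)]
        have "exp (- L (\<gamma> r) / \<gamma> r) \<le>
            exp (- ((m / sqrt (\<gamma> r) + 1)\<^sup>2 / 2)) / sqrt (2 * pi) - exp (- (\<mu>\<^sup>2 / 2 * b) / \<gamma> r)"
          unfolding L_def using elim(1) \<gamma> by (intro gaussian_tail_dominates) (auto simp: L_def)
        also have "\<dots> \<le> P r {w..<b}"
          using standard_brownian_motion.prob_scaled_last_zero_between_ge[OF assms(3)[OF elim(3)] True _ _ elim(3) \<gamma>, of b t \<mu>]
            elim(2) e(1) \<open>t > 0\<close> by (simp add: P_def W_def m_def b_def field_simps)
        also have "\<dots> \<le> P r G"
          using sub elim(3) \<open>open G\<close> by (intro P_mono) auto
        finally show ?case using \<gamma> by (rule scaled_log_prob_ge)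
      qed
      have "((\<lambda>r. ereal (- L (\<gamma> r))) \<longlongrightarrow> - J w) at_top"
        using L True by (auto simp: J_def intro!: tendsto_intros)
      then have "- J w = Liminf at_top (\<lambda>r. ereal (- L (\<gamma> r)))"
        by (simp add: lim_imp_Liminf)
      also have "\<dots> \<le> ?lim" using ev by (rule Liminf_mono)
      finally show ?thesis .
    qed (simp add: J_def)
    then have "- ?lim \<le> (INF w\<in>G. J w)"
      by (intro INF_greatest) (simp add: ereal_uminus_le_reorder)
    then show ?thesis by (simp add: ereal_uminus_le_reorder)
  qed
  have "good_rate_function J"
    unfolding good_rate_function_def
  proof (intro allI impI)
    fix \<eta> :: real assume "\<eta> \<ge> 0"
    have "{w. J w \<le> ereal \<eta>} = {0..\<eta> / (\<mu>\<^sup>2 / 2)}"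
      using \<mu>2 by (auto simp: J_def field_simps split: if_splits)
    then show "compact {w. J w \<le> ereal \<eta>}" by simp
  qed
  moreover have "0 \<le> J w" for w using \<mu>2 by (simp add: J_def)
  moreover have "large_deviation_principle M W (\<lambda>r. 1 / \<gamma> r) J"
    unfolding large_deviation_principle_def
    by (intro conjI allI impI prob W_meas speed lsc upper[unfolded P_def] lower[unfolded P_def] \<open>\<And>w. 0 \<le> J w\<close>)
  ultimately show ?thesis unfolding W_def by blast
qed

end
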